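(* Let $m\geqslant 3$, $n\geqslant 3$, $M\geqslant m$, $N\geqslant n$ be odd integers and let $X$ be a partial bicentrally balanced $C_4$-face-magic labeling on the $m\times n$ subgrid of $\mathcal{P}_{M,N}$. If $r$ is an odd positive integer with $mr\leqslant M$, then $\mathrm{HASC}^r(X)$ is a partial bicentrally balanced $C_4$-face-magic labeling on the $mr\times n$ subgrid of $\mathcal{P}_{M,N}$. Similarly, if $r$ is an odd positive integer with $nr\leqslant N$, then $\mathrm{VASC}^r(X)$ is a partial bicentrally balanced $C_4$-face-magic labeling on the $m\times nr$ subgrid of $\mathcal{P}_{M,N}$.
   Context: For odd $p,q\geqslant 3$ with $p\leqslant M$, $q\leqslant N$, write $p=2p_0+1$, $q=2q_0+1$, $p_0^{+}=p_0+1$, $q_0^{+}=q_0+1$, $\mathrm{Grid}(p,q)=\{(i,j):1\leqslant i\leqslant p,1\leqslant j\leqslant q\}$, with planar grid graph $P_p\times P_q$ whose 4-cycle faces are $\{(i,j),(i+1,j),(i,j+1),(i+1,j+1)\}$. A labeling $X=\{x_{i,j}:(i,j)\in\mathrm{Grid}(p,q)\}$ is a partial bicentrally balanced $C_4$-face-magic labeling on the $p\times q$ subgrid of $\mathcal{P}_{M,N}$ if: (1) every 4-cycle face of $P_p\times P_q$ has label sum $2MN+3$; (2) $\{x_{i,j}: i+j\text{ even}\}=\{1,\ldots,\tfrac12 pq+\tfrac12\}$; (3) $\{x_{i,j}: i+j\text{ odd}\}=\{MN-\tfrac12 pq+\tfrac32,\ldots,MN\}$; (4) $x_{i,j}+x_{p+1-i,q+1-j}=\tfrac12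 pq+\tfrac32$ if $i+j$ even; (5) $x_{i,j}+x_{p+1-i,q+1-j}=2MN-\tfrac12 pq+\tfrac32$ if $i+j$ odd; (6) $x_{i,q_0^{+}}<x_{i+2,q_0^{+}}$ for $1\leqslant i\leqslant p-2$ with $i+q_0^{+}$ even, $x_{i,q_0^{+}}>x_{i+2,q_0^{+}}$ for $1\leqslant i\leqslant p-2$ with $i+q_0^{+}$ odd, $x_{p_0^{+},j}<x_{p_0^{+},j+2}$ for $1\leqslant j\leqslant q-2$ with $p_0^{+}+j$ even, and $x_{p_0^{+},j}>x_{p_0^{+},j+2}$ for $1\leqslant j\leqslant q-2$ with $p_0^{+}+j$ odd. For $X$ on $\mathrm{Grid}(m,n)$ and odd $r=2r_0+1\geqslant 1$: $\mathrm{HASC}^r(X)=\{y_{i,j}:(i,j)\in\mathrm{Grid}(mr,n)\}$ is defined for all $(i,j)\in\mathrm{Grid}(m,n)$ by: $y_{(2k-1)m+i,j}=MN-x_{i,j}+(k-\tfrac12)mn+\tfrac32$ if $1\leqslant k\leqslant r_0$ and $i+j$ odd; $y_{(2k-1)m+i,j}=MN-x_{i,j}-(k-\tfrac12)mn+\tfrac32$ if $1\leqslant k\leqslant r_0$ and $i+j$ even; $y_{2km+i,j}=x_{i,j}-kmn$ if $0\leqslant k\leqslant r_0$ and $i+j$ odd; $y_{2km+i,j}=x_{i,j}+kmn$ if $0\leqslant k\leqslant r_0$ and $i+j$ even. $\mathrm{VASC}^r(X)=\{y_{i,j}:(i,j)\in\mathrm{Grid}(m,nr)\}$ is defined by the same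 formulas with the shifts applied to the second coordinate: $y_{i,(2k-1)n+j}$ and $y_{i,2kn+j}$ in place of $y_{(2k-1)m+i,j}$ and $y_{2km+i,j}$ (with the same right-hand sides). For $r=1$ both equal $X$. *)

theory Defs
  imports Main
begin

text \<open>
  Labelings are functions of the two (1-based) coordinates with integer values; only the values
  on the relevant grid matter. All occurrences of \<open>div 2\<close> below that come from halves in
  the usual formulas are exact, because they are applied to even numbers whenever the side
  lengths are odd: for odd \<open>s\<close>,
  \<open>s/2 + 1/2 = (s + 1) div 2\<close>, \<open>s/2 + 3/2 = (s + 3) div 2\<close> and \<open>- s/2 + 3/2 = (3 - s) div 2\<close>.
\<close>

definition Grid :: "nat \<Rightarrow> nat \<Rightarrow> (nat \<times> nat) set" where
  "Grid p q = {1..p} \<times> {1..q}"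

text \<open>The middle row \<open>p\<^sub>0\<^sup>+ = p\<^sub>0 + 1\<close> of a grid with \<open>p = 2 p\<^sub>0 + 1\<close> rows.\<close>

definition mid :: "nat \<Rightarrow> nat" where
  "mid p = (p - 1) div 2 + 1"

definition partial_bicentrally_balanced ::
    "nat \<Rightarrow> nat \<Rightarrow> nat \<Rightarrow> nat \<Rightarrow> (nat \<Rightarrow> nat \<Rightarrow> int) \<Rightarrow> bool" where
  "partial_bicentrally_balanced M N p q x \<longleftrightarrow>
     odd p \<and> odd q \<and> 3 \<le> p \<and> 3 \<le> q \<and> p \<le> M \<and> q \<le> N \<and>
     (\<forall>i j. 1 \<le> i \<and> i + 1 \<le> p \<and> 1 \<le> j \<and> j + 1 \<le> q \<longrightarrow>
        x i j + x (i + 1) j + x i (j + 1) + x (i + 1) (j + 1) = 2 * (int M * int N) + 3) \<and>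
     {x i j | i j. (i, j) \<in> Grid p q \<and> even (i + j)} =
        {1 .. (int p * int q + 1) div 2} \<and>
     {x i j | i j. (i, j) \<in> Grid p q \<and> odd (i + j)} =
        {int M * int N + (3 - int p * int q) div 2 .. int M * int N} \<and>
     (\<forall>(i, j) \<in> Grid p q. even (i + j) \<longrightarrow>
        x i j + x (p + 1 - i) (q + 1 - j) = (int p * int q + 3) div 2) \<and>
     (\<forall>(i, j) \<in> Grid p q. odd (i + j) \<longrightarrow>
        x i j + x (p + 1 - i) (q + 1 - j) = 2 * (int M * int N) + (3 - int p * int q) div 2) \<and>
     (\<forall>i \<in> {1..p - 2}. even (i + mid q) \<longrightarrow> x i (mid q) < x (i + 2) (mid q)) \<and>
     (\<forall>i \<in> {1..p - 2}. odd (i + mid q) \<longrightarrow> x i (mid q) > x (i + 2) (mid q)) \<and>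
     (\<forall>j \<in> {1..q - 2}. even (mid p + j) \<longrightarrow> x (mid p) j < x (mid p) (j + 2)) \<and>
     (\<forall>j \<in> {1..q - 2}. odd (mid p + j) \<longrightarrow> x (mid p) j > x (mid p) (j + 2))"

text \<open>
  The label written into the cell of the \<open>b\<close>-th copy (\<open>b = 0, 1, \<dots>\<close>) of the \<open>m \<times> n\<close> grid that
  corresponds to the cell \<open>(i, j)\<close> of the original grid. Here \<open>b = 2 k - 1\<close> or \<open>b = 2 k\<close>, so that
  \<open>k = (b + 1) div 2\<close> in both cases.
\<close>

definition asc_label ::
    "nat \<Rightarrow> nat \<Rightarrow> nat \<Rightarrow> nat \<Rightarrow> (nat \<Rightarrow> nat \<Rightarrow> int) \<Rightarrow> nat \<Rightarrow> nat \<Rightarrow> nat \<Rightarrow> int" where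
  "asc_label M N m n x b i j =
     (let k = int ((b + 1) div 2); s = int m * int n in
      if odd b then
        (if odd (i + j) then int M * int N - x i j + ((2 * k - 1) * s + 3) div 2
         else int M * int N - x i j + (3 - (2 * k - 1) * s) div 2)
      else
        (if odd (i + j) then x i j - k * s else x i j + k * s))"

definition HASC ::
    "nat \<Rightarrow> nat \<Rightarrow> nat \<Rightarrow> nat \<Rightarrow> nat \<Rightarrow> (nat \<Rightarrow> nat \<Rightarrow> int) \<Rightarrow> nat \<Rightarrow> nat \<Rightarrow> int" where
  "HASC M N m n r x i j =
     (if (i, j) \<in> Grid (m * r) n
      then asc_label M N m n x ((i - 1) div m) ((i - 1) mod m + 1) j
      else undefined)"

definition VASC ::
    "nat \<Rightarrow> nat \<Rightarrow> nat \<Rightarrow> nat \<Rightarrow> nat \<Rightarrow> (nat \<Rightarrow> nat \<Rightarrow> int) \<Rightarrow> nat \<Rightarrow> nat \<Rightarrow> int" where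
  "VASC M N m n r x i j =
     (if (i, j) \<in> Grid m (n * r)
      then asc_label M N m n x ((j - 1) div n) i ((j - 1) mod n + 1)
      else undefined)"

text \<open>
  With \<open>b = 2 k - 1\<close> and \<open>b = 2 k\<close> the next four facts give the usual case-wise definition of
  both constructions in terms of the shifted coordinates.
\<close>

lemma HASC_block:
  assumes "(i, j) \<in> Grid m n" and "b < r"
  shows "HASC M N m n r x (b * m + i) j = asc_label M N m n x b i j"
proof -
  have i: "1 \<le> i" "i \<le> m" and j: "j \<in> {1..n}" using assms(1) by (auto simp: Grid_def)
  have "b * m + i \<le> Suc b * m" using i by simp
  also have "\<dots> \<le> r * m" using assms(2) by (intro mult_le_mono1) simp
  finally have "(b * m + i, j) \<in> Grid (m * r) n"
    using i j by (simp add: Grid_def mult.commute)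
  moreover obtain c where c: "i = Suc c" "c < m" using i by (cases i) auto
  have "(b * m + i - 1) div m = b" "(b * m + i - 1) mod m + 1 = i"
    using c by auto
  ultimately show ?thesis by (simp add: HASC_def)
qed

lemma VASC_block:
  assumes "(i, j) \<in> Grid m n" and "b < r"
  shows "VASC M N m n r x i (b * n + j) = asc_label M N m n x b i j"
proof -
  have j: "1 \<le> j" "j \<le> n" and i: "i \<in> {1..m}" using assms(1) by (auto simp: Grid_def)
  have "b * n + j \<le> Suc b * n" using j by simp
  also have "\<dots> \<le> r * n" using assms(2) by (intro mult_le_mono1) simp
  finally have "(i, b * n + j) \<in> Grid m (n * r)"
    using i j by (simp add: Grid_def mult.commute)
  moreover obtain c where c: "j = Suc c" "c < n" using j by (cases j) auto
  have "(b * n + j - 1) div n = b" "(b * n + j - 1) mod n + 1 = j"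
    using c by auto
  ultimately show ?thesis by (simp add: VASC_def)
qed

lemma asc_label_odd:
  assumes "1 \<le> k"
  shows "asc_label M N m n x (2 * k - 1) i j =
    (if odd (i + j) then int M * int N - x i j + ((2 * int k - 1) * (int m * int n) + 3) div 2
     else int M * int N - x i j + (3 - (2 * int k - 1) * (int m * int n)) div 2)"
  using assms by (simp add: asc_label_def Let_def)

lemma asc_label_even:
  "asc_label M N m n x (2 * k) i j =
    (if odd (i + j) then x i j - int k * (int m * int n) else x i j + int k * (int m * int n))"
  by (simp add: asc_label_def Let_def)

end

theory Submission
  imports Defs
begin

text \<open>
  Write \<open>s = m n\<close> and number the copies of the grid by \<open>b = 0, \<dots>, r - 1\<close>. Since \<open>m\<close> is odd, the
  checkerboard parity of a cell is flipped in the copies with odd \<open>b\<close>, and exactly there the labels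
  are reflected; this is why the balance and monotonicity conditions carry over inside one copy.
  The labels of the even cells of copy \<open>b\<close> fill the interval between \<open>\<lfloor>(b s + 1) / 2\<rfloor>\<close> and
  \<open>\<lfloor>((b + 1) s + 1) / 2\<rfloor>\<close>, those of the odd cells fill the interval between
  \<open>M N - \<lfloor>(b + 1) s / 2\<rfloor>\<close> and \<open>M N - \<lfloor>b s / 2\<rfloor>\<close>. These intervals are consecutive, which gives both the
  label sets and the monotonicity across the border of two copies. The faces across such a border
  have the correct sum because the sums of two horizontally adjacent labels alternate from row to
  row, so that they agree in the first and in the last of the \<open>m\<close> rows. The vertical construction
  is the transpose of the horizontal one.
\<close>

section \<open>Arithmetic of shifts, unions of intervals, block coordinates\<close>

lemma asc_label_double:
  assumes "int m * int n = 2 * t + 1"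
  shows "asc_label M N m n x (2 * k) i j =
    (if odd (i + j) then x i j - int k * (2 * t + 1) else x i j + int k * (2 * t + 1))"
  using assms by (simp add: asc_label_even)

text \<open>Index \<open>Suc (2 * k)\<close> is \<open>2 * (k + 1) - 1\<close>, so the shift of odd
  cells is \<open>(k + 1/2) * s + 3/2\<close> with \<open>s = 2 * t + 1\<close>, that is
  \<open>k * s + t + 2\<close>.\<close>

lemma asc_label_Suc_double:
  assumes "int m * int n = 2 * t + 1"
  shows "asc_label M N m n x (Suc (2 * k)) i j =
    (if odd (i + j) then int M * int N - x i j + int k * (2 * t + 1) + t + 2
     else int M * int N - x i j - int k * (2 * t + 1) - t + 1)"
proof -
  have "((2 * int (Suc k) - 1) * (2 * t + 1) + 3) = 2 * (int k * (2 * t + 1) + t + 2)"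
    "(3 - (2 * int (Suc k) - 1) * (2 * t + 1)) = 2 * (- int k * (2 * t + 1) - t + 1)"
    by (simp_all add: algebra_simps)
  then have "((2 * int (Suc k) - 1) * (2 * t + 1) + 3) div 2 = int k * (2 * t + 1) + t + 2"
    "(3 - (2 * int (Suc k) - 1) * (2 * t + 1)) div 2 = - int k * (2 * t + 1) - t + 1"
    by simp_all
  then show ?thesis
    using asc_label_odd[of "Suc k" M N m n x i j] assms by simp
qed

text \<open>The floors count the even and the odd cells in the first \<open>b\<close> copies, which
  together hold \<open>b * s\<close> cells. They give the endpoints of the label intervals.\<close>

lemma half_multiples:
  fixes s t :: int
  assumes "s = 2 * t + 1"
  shows "(int (2 * k) * s + 1) div 2 = int k * s"
    and "(int (Suc (2 * k)) * s + 1) div 2 = int k * s + t + 1"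
    and "int (2 * k) * s div 2 = int k * s"
    and "int (Suc (2 * k)) * s div 2 = int k * s + t"
proof -
  have e: "int (2 * k) * s + 1 = 2 * (int k * s) + 1"
    "int (Suc (2 * k)) * s + 1 = 2 * (int k * s + t + 1)"
    "int (2 * k) * s = 2 * (int k * s)"
    "int (Suc (2 * k)) * s = 2 * (int k * s + t) + 1"
    using assms by (simp_all add: algebra_simps)
  show "(int (2 * k) * s + 1) div 2 = int k * s" unfolding e(1) by simp
  show "(int (Suc (2 * k)) * s + 1) div 2 = int k * s + t + 1" unfolding e(2) by simp
  show "int (2 * k) * s div 2 = int k * s" unfolding e(3) by simp
  show "int (Suc (2 * k)) * s div 2 = int k * s + t" unfolding e(4) by simp
qed

text \<open>Half-open intervals can share an endpoint without overlapping, so consecutive ones glue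
  with no gap and no corrections by 1.\<close>

lemma UN_consecutive_intervals:
  fixes g :: "nat \<Rightarrow> int"
  assumes "mono g"
  shows "(\<Union>b<r. {g b <.. g (Suc b)}) = {g 0 <.. g r}"
proof (induction r)
  case (Suc r)
  have "g 0 \<le> g r" "g r \<le> g (Suc r)" using assms by (auto intro: monoD)
  then show ?case using Suc by (auto simp: lessThan_Suc)
qed simp

lemma UN_consecutive_intervals_antimono:
  fixes g :: "nat \<Rightarrow> int"
  assumes "antimono g"
  shows "(\<Union>b<r. {g (Suc b) <.. g b}) = {g r <.. g 0}"
proof (induction r)
  case (Suc r)
  have "g r \<le> g 0" "g (Suc r) \<le> g r" using assms by (auto intro: antimonoD)
  then show ?case using Suc by (auto simp: lessThan_Suc)
qed simp

text \<open>Two neighbouring sums share their middle term, so \<open>f\<close> repeats after two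
  steps.\<close>

lemma alternating_sum_eq_first:
  fixes f :: "nat \<Rightarrow> int"
  assumes "\<And>i. 1 \<le> i \<Longrightarrow> i + 1 \<le> m \<Longrightarrow> f i + f (i + 1) = S" and "2 * k + 1 \<le> m"
  shows "f (2 * k + 1) = f 1"
  using assms(2)
proof (induction k)
  case (Suc k)
  have "f (2 * k + 1) + f (2 * k + 2) = S" "f (2 * k + 2) + f (2 * k + 3) = S"
    using assms(1)[of "2 * k + 1"] assms(1)[of "2 * k + 2"] Suc.prems
    by (simp_all add: numeral_eq_Suc)
  moreover have "f (2 * k + 1) = f 1" using Suc by simp
  ultimately show ?case by (simp add: numeral_eq_Suc)
qed simp

lemma block_coordinates:
  fixes m r I :: nat
  assumes "I \<in> {1..m * r}"
  obtains b i where "b < r" "i \<in> {1..m}" "I = b * m + i"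
proof
  have "m > 0" using assms by (cases m) auto
  have "I - 1 < r * m" using assms by (auto simp: mult.commute)
  then show "(I - 1) div m < r" using \<open>m > 0\<close> by (simp add: div_less_iff_less_mult)
  show "(I - 1) mod m + 1 \<in> {1..m}" using \<open>m > 0\<close> by (simp add: Suc_leI)
  show "I = (I - 1) div m * m + ((I - 1) mod m + 1)"
    using assms div_mult_mod_eq[of "I - 1" m] by simp
qed

lemma block_index_in_range:
  fixes m r b i :: nat
  assumes "b < r" "i \<in> {1..m}"
  shows "b * m + i \<in> {1..m * r}"
proof -
  have "b * m + i \<le> Suc b * m" using assms(2) by simp
  also have "\<dots> \<le> r * m" using assms(1) by (intro mult_le_mono1) simp
  finally show ?thesis using assms(2) by (simp add: mult.commute)
qed

lemma image_set_comprehension2: "f ` {x i j | i j. P i j} = {f (x i j) | i j. P i j}"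
  by auto

section \<open>Properties of the original labeling\<close>

locale balanced_labeling =
  fixes M N m n :: nat and x :: "nat \<Rightarrow> nat \<Rightarrow> int" and s t :: int
  assumes balanced: "partial_bicentrally_balanced M N m n x"
    and s_def: "s = int m * int n"
    and s_eq: "s = 2 * t + 1"
begin

lemma odd_m: "odd m" and odd_n: "odd n" and m_ge: "3 \<le> m" and n_ge: "3 \<le> n"
  and n_le: "n \<le> N"
  using balanced by (simp_all add: partial_bicentrally_balanced_def)

lemma face_sum:
  assumes "1 \<le> i" "i + 1 \<le> m" "1 \<le> j" "j + 1 \<le> n"
  shows "x i j + x (i + 1) j + x i (j + 1) + x (i + 1) (j + 1) = 2 * (int M * int N) + 3"
  using balanced assms by (simp add: partial_bicentrally_balanced_def)

lemma even_labels: "{x i j | i j. (i, j) \<in> Grid m n \<and> even (i + j)} = {1..t + 1}"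
proof -
  have "(s + 1) div 2 = t + 1" using s_eq by simp
  then show ?thesis using balanced by (simp add: partial_bicentrally_balanced_def s_def)
qed

lemma odd_labels:
  "{x i j | i j. (i, j) \<in> Grid m n \<and> odd (i + j)} = {int M * int N - t + 1..int M * int N}"
proof -
  have "(3 - s) div 2 = 1 - t" using s_eq by simp
  then show ?thesis using balanced
    by (simp add: partial_bicentrally_balanced_def s_def algebra_simps)
qed

lemma balance:
  assumes "(i, j) \<in> Grid m n"
  shows "x i j + x (m + 1 - i) (n + 1 - j) =
    (if even (i + j) then t + 2 else 2 * (int M * int N) - t + 1)"
proof -
  have "(s + 3) div 2 = t + 2" "(3 - s) div 2 = 1 - t" using s_eq by simp_all
  then show ?thesis using balanced assms
    by (auto simp: partial_bicentrally_balanced_def s_def)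
qed

lemma mid_column_mono:
  assumes "1 \<le> i" "i + 2 \<le> m"
  shows "if even (i + mid n) then x i (mid n) < x (i + 2) (mid n)
    else x i (mid n) > x (i + 2) (mid n)"
proof -
  have "i \<in> {1..m - 2}" using assms by auto
  then show ?thesis using balanced by (simp add: partial_bicentrally_balanced_def)
qed

lemma mid_row_mono:
  assumes "j \<in> {1..n - 2}"
  shows "if even (mid m + j) then x (mid m) j < x (mid m) (j + 2)
    else x (mid m) j > x (mid m) (j + 2)"
  using balanced assms by (simp add: partial_bicentrally_balanced_def)

text \<open>By \<open>face_sum\<close> the pair sums in rows \<open>i\<close> and
  \<open>i + 1\<close> add up to a constant, so \<open>alternating_sum_eq_first\<close> applies; row
  \<open>m\<close> is reached because \<open>m\<close> is odd.\<close>

lemma first_last_row_sum: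
  assumes "1 \<le> j" "j + 1 \<le> n"
  shows "x m j + x m (j + 1) = x 1 j + x 1 (j + 1)"
proof -
  obtain k where k: "m = 2 * k + 1" using odd_m by (auto elim: oddE)
  have "x i j + x i (j + 1) + (x (i + 1) j + x (i + 1) (j + 1)) = 2 * (int M * int N) + 3"
    if "1 \<le> i" "i + 1 \<le> m" for i
    using face_sum[OF that assms] by simp
  from alternating_sum_eq_first[of m "\<lambda>i. x i j + x i (j + 1)", OF this, of k]
  show ?thesis using k by simp
qed

section \<open>Labels inside one copy and in neighbouring or opposite copies\<close>

abbreviation lab :: "nat \<Rightarrow> nat \<Rightarrow> nat \<Rightarrow> int" where
  "lab \<equiv> asc_label M N m n x"

lemma lab_double:
  "lab (2 * k) i j = (if odd (i + j) then x i j - int k * s else x i j + int k * s)"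
  using asc_label_double[of m n t M N x k i j] s_def s_eq by simp

lemma lab_Suc_double:
  "lab (Suc (2 * k)) i j =
    (if odd (i + j) then int M * int N - x i j + int k * s + t + 2
     else int M * int N - x i j - int k * s - t + 1)"
  using asc_label_Suc_double[of m n t M N x k i j] s_def s_eq by simp

text \<open>The left side is the colour of a cell in the large grid, \<open>i + j\<close> gives its
  colour inside the copy; \<open>b * m\<close> has the parity of \<open>b\<close>.\<close>

lemma parity_block: "even (b * m + i + j) \<longleftrightarrow> (even b \<longleftrightarrow> even (i + j))"
  using odd_m by auto

text \<open>For even \<open>b\<close> the low labels \<open>{1..t + 1}\<close> are shifted up. For
  odd \<open>b\<close> the cells in question are odd inside the copy, and their \<open>t\<close>
  high labels are reflected down. Copies thus contribute \<open>t + 1\<close> and \<open>t\<close>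
  labels in turn, which the floors express for both parities at once.\<close>

lemma block_even_labels:
  "{lab b i j | i j. (i, j) \<in> Grid m n \<and> even (b * m + i + j)} =
    {(int b * s + 1) div 2 <.. (int (Suc b) * s + 1) div 2}" (is "?L = _")
proof (cases "even b")
  case True
  then obtain k where k: "b = 2 * k" by blast
  have "?L = (\<lambda>v. v + int k * s) ` {x i j | i j. (i, j) \<in> Grid m n \<and> even (i + j)}"
    unfolding k parity_block lab_double image_set_comprehension2
    by (intro Collect_cong iff_exI) auto
  also have "\<dots> = {int k * s + 1 .. int k * s + t + 1}"
    unfolding even_labels image_add_atLeastAtMost' by (simp add: algebra_simps)
  also have "\<dots> = {int k * s <.. int k * s + t + 1}" by auto
  finally show ?thesis unfolding k half_multiples[OF s_eq] .
next
  case False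
  then obtain k where k: "b = Suc (2 * k)" by (auto elim: oddE)
  have "?L = (\<lambda>v. (int M * int N + int k * s + t + 2) - v) `
      {x i j | i j. (i, j) \<in> Grid m n \<and> odd (i + j)}"
    unfolding k parity_block lab_Suc_double image_set_comprehension2
    by (intro Collect_cong iff_exI) auto
  also have "\<dots> = {int k * s + t + 2 .. int k * s + 2 * t + 1}"
    unfolding odd_labels image_diff_atLeastAtMost by (simp add: algebra_simps)
  \<comment> \<open>The upper end \<open>k * s + 2 * t + 1\<close> is \<open>(k + 1) * s\<close>,
    where the interval of the next copy begins.\<close>
  also have "\<dots> = {int k * s + t + 1 <.. int (Suc k) * s}"
    using s_eq by (auto simp: algebra_simps)
  finally show ?thesis
    using half_multiples(1)[OF s_eq, of "Suc k"] half_multiples(2)[OF s_eq, of k]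
    by (simp add: k)
qed

text \<open>The same argument with high and low labels exchanged, descending from
  \<open>M * N\<close> by \<open>t\<close> and \<open>t + 1\<close> labels in turn.\<close>

lemma block_odd_labels:
  "{lab b i j | i j. (i, j) \<in> Grid m n \<and> odd (b * m + i + j)} =
    {int M * int N - int (Suc b) * s div 2 <.. int M * int N - int b * s div 2}" (is "?L = _")
proof (cases "even b")
  case True
  then obtain k where k: "b = 2 * k" by blast
  have "?L = (\<lambda>v. v + - (int k * s)) ` {x i j | i j. (i, j) \<in> Grid m n \<and> odd (i + j)}"
    unfolding k parity_block lab_double image_set_comprehension2
    by (intro Collect_cong iff_exI) auto
  also have "\<dots> = {int M * int N - (int k * s + t) + 1 .. int M * int N - int k * s}"
    unfolding odd_labels image_add_atLeastAtMost' by (simp add: algebra_simps)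
  also have "\<dots> = {int M * int N - (int k * s + t) <.. int M * int N - int k * s}" by auto
  finally show ?thesis unfolding k half_multiples[OF s_eq] .
next
  case False
  then obtain k where k: "b = Suc (2 * k)" by (auto elim: oddE)
  have "?L = (\<lambda>v. (int M * int N - int k * s - t + 1) - v) `
      {x i j | i j. (i, j) \<in> Grid m n \<and> even (i + j)}"
    unfolding k parity_block lab_Suc_double image_set_comprehension2
    by (intro Collect_cong iff_exI) auto
  also have "\<dots> = {int M * int N - int k * s - 2 * t .. int M * int N - int k * s - t}"
    unfolding even_labels image_diff_atLeastAtMost by (simp add: algebra_simps)
  also have "\<dots> = {int M * int N - int (Suc k) * s <.. int M * int N - (int k * s + t)}"
    using s_eq by (auto simp: algebra_simps)
  finally show ?thesis
    using half_multiples(3)[OF s_eq, of "Suc k"] half_multiples(4)[OF s_eq, of k]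
    by (simp add: k)
qed

text \<open>For each colour the label intervals of copies \<open>b\<close> and \<open>b + 1\<close>
  are adjacent and disjoint, so the comparison holds wherever the two cells lie in their
  copies.\<close>

lemma lab_next_block:
  assumes "(i, j) \<in> Grid m n" "(i', j') \<in> Grid m n"
    and "even (b * m + i + j) \<longleftrightarrow> even (Suc b * m + i' + j')"
  shows "if even (b * m + i + j) then lab b i j < lab (Suc b) i' j'
    else lab b i j > lab (Suc b) i' j'"
proof (cases "even (b * m + i + j)")
  case True
  then have "lab b i j \<in> {(int b * s + 1) div 2 <.. (int (Suc b) * s + 1) div 2}"
    "lab (Suc b) i' j' \<in> {(int (Suc b) * s + 1) div 2 <.. (int (Suc (Suc b)) * s + 1) div 2}"
    using assms unfolding block_even_labels[symmetric] by blast+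
  then show ?thesis using True by auto
next
  case False
  then have "lab b i j \<in> {int M * int N - int (Suc b) * s div 2 <.. int M * int N - int b * s div 2}"
    "lab (Suc b) i' j' \<in>
      {int M * int N - int (Suc (Suc b)) * s div 2 <.. int M * int N - int (Suc b) * s div 2}"
    using assms unfolding block_odd_labels[symmetric] by blast+
  then show ?thesis using False by auto
qed

text \<open>Within one copy and colour the labels are translated or reflected. Odd copies reverse
  the order as well as the colour, so the monotonicity conditions keep their form.\<close>

lemma lab_less_iff:
  assumes "even (i + j) \<longleftrightarrow> even (i' + j')"
  shows "lab b i j < lab b i' j' \<longleftrightarrow> (if even b then x i j < x i' j' else x i' j' < x i j)"
proof (cases "even b")
  case True
  then obtain k where "b = 2 * k" by blast
  then show ?thesis using assms by (auto simp: lab_double)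
next
  case False
  then obtain k where "b = Suc (2 * k)" by (auto elim: oddE)
  then show ?thesis using assms by (auto simp: lab_Suc_double)
qed

text \<open>Neighbours have opposite colours, so their shifts by multiples of \<open>s\<close>
  cancel; in odd copies the constants \<open>t + 2\<close> and \<open>- t + 1\<close> leave
  3.\<close>

lemma lab_adjacent_sum:
  "lab b i j + lab b i (j + 1) =
    (if even b then x i j + x i (j + 1) else 2 * (int M * int N) + 3 - (x i j + x i (j + 1)))"
proof (cases "even b")
  case True
  then obtain k where "b = 2 * k" by blast
  then show ?thesis by (auto simp: lab_double)
next
  case False
  then obtain k where "b = Suc (2 * k)" by (auto elim: oddE)
  then show ?thesis by (auto simp: lab_Suc_double)
qed

text \<open>Opposite copies \<open>b\<close> and \<open>2 * r0 - b\<close> have the same parity.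
  Their shift multiples add up to \<open>r0\<close> for even \<open>b\<close>, but to
  \<open>r0 - 1\<close> for odd \<open>b\<close>; there the missing \<open>s = 2 * t + 1\<close>
  comes from the reflection constants and the balance of the other colour.\<close>

lemma lab_balance:
  assumes g: "(i, j) \<in> Grid m n" and b: "b \<le> 2 * r0"
  shows "lab b i j + lab (2 * r0 - b) (m + 1 - i) (n + 1 - j) =
    (if even (b * m + i + j) then int r0 * s + t + 2
     else 2 * (int M * int N) - int r0 * s - t + 1)"
proof -
  \<comment> \<open>The point reflection preserves colours because \<open>m + n + 2\<close> is
    even.\<close>
  have p: "even (m + 1 - i + (n + 1 - j)) \<longleftrightarrow> even (i + j)"
    using g odd_m odd_n by (auto simp: Grid_def)
  show ?thesis
  proof (cases "even b")
    case True
    then obtain k where k: "b = 2 * k" by blast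
    obtain k' where r0: "r0 = k + k'" using b k le_Suc_ex by auto
    have b': "2 * r0 - b = 2 * k'" using k r0 by simp
    show ?thesis unfolding b' unfolding k parity_block lab_double p r0
      using balance[OF g] by (auto simp: algebra_simps)
  next
    case False
    then obtain k where k: "b = Suc (2 * k)" by (auto elim: oddE)
    obtain k' where r0: "r0 = Suc k + k'" using b k le_Suc_ex[of "Suc k" r0] by auto
    have b': "2 * r0 - b = Suc (2 * k')" using k r0 by simp
    show ?thesis unfolding b' unfolding k parity_block lab_Suc_double p r0
      using balance[OF g] s_eq by (auto simp: algebra_simps)
  qed
qed

section \<open>Assembling the copies: the horizontal construction\<close>

lemma HASC_lab:
  assumes "b < r" "i \<in> {1..m}" "j \<in> {1..n}"
  shows "HASC M N m n r x (b * m + i) j = lab b i j"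
  using HASC_block[of i j m n b r M N x] assms by (simp add: Grid_def)

text \<open>Stated for any \<open>P\<close> so that it serves both colours.\<close>

lemma HASC_label_set:
  "{HASC M N m n r x i j | i j. (i, j) \<in> Grid (m * r) n \<and> P (i + j)} =
    (\<Union>b<r. {lab b i j | i j. (i, j) \<in> Grid m n \<and> P (b * m + i + j)})" (is "?L = ?R")
proof
  show "?L \<subseteq> ?R"
  proof
    fix v assume "v \<in> ?L"
    then obtain I j where v: "v = HASC M N m n r x I j" "I \<in> {1..m * r}" "j \<in> {1..n}" "P (I + j)"
      by (auto simp: Grid_def)
    obtain b i where bi: "b < r" "i \<in> {1..m}" "I = b * m + i"
      using v(2) by (rule block_coordinates)
    then have "v = lab b i j" using v HASC_lab by simp
    then show "v \<in> ?R" using v bi by (fastforce simp: Grid_def)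
  qed
  show "?R \<subseteq> ?L"
  proof
    fix v assume "v \<in> ?R"
    then obtain b i j where v: "b < r" "v = lab b i j" "i \<in> {1..m}" "j \<in> {1..n}"
      "P (b * m + i + j)" by (auto simp: Grid_def)
    have "v = HASC M N m n r x (b * m + i) j" "(b * m + i, j) \<in> Grid (m * r) n"
      using v HASC_lab block_index_in_range[of b r i m] by (auto simp: Grid_def)
    then show "v \<in> ?L" using v(5) by blast
  qed
qed

text \<open>Inside an odd copy the face sum of \<open>x\<close> is subtracted from twice its value
  \<open>2 * M * N + 3\<close>, which leaves it unchanged. Across a border one pair sum is kept and
  the other subtracted from \<open>2 * M * N + 3\<close>; they cancel by
  \<open>first_last_row_sum\<close>.\<close>

lemma HASC_face_sum:
  assumes "1 \<le> I" "I + 1 \<le> m * r" "1 \<le> j" "j + 1 \<le> n"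
  shows "HASC M N m n r x I j + HASC M N m n r x (I + 1) j + HASC M N m n r x I (j + 1)
    + HASC M N m n r x (I + 1) (j + 1) = 2 * (int M * int N) + 3"
proof -
  have "I \<in> {1..m * r}" using assms by simp
  then obtain b i where bi: "b < r" "i \<in> {1..m}" "I = b * m + i"
    by (rule block_coordinates)
  have j: "j \<in> {1..n}" "j + 1 \<in> {1..n}" using assms by auto
  show ?thesis
  proof (cases "i = m")
    case False
    then have i: "i + 1 \<in> {1..m}" using bi by auto
    have I: "I + 1 = b * m + (i + 1)" using bi by simp
    show ?thesis
      unfolding I unfolding bi(3)
      using HASC_lab[OF bi(1,2) j(1)] HASC_lab[OF bi(1,2) j(2)]
        HASC_lab[OF bi(1) i j(1)] HASC_lab[OF bi(1) i j(2)]
        lab_adjacent_sum[of b i j] lab_adjacent_sum[of b "i + 1" j] face_sum[of i j] i bi(2) assms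
      by (auto split: if_splits)
  next
    case True
    have I: "I + 1 = Suc b * m + 1" using bi True by simp
    have "Suc b * m < m * r" using assms(2) bi True by simp
    then have b: "Suc b < r" using mult.commute[of m r] by (metis mult_less_cancel2)
    have i: "1 \<in> {1..m}" using m_ge by simp
    show ?thesis
      unfolding I unfolding bi(3)
      using HASC_lab[OF bi(1,2) j(1)] HASC_lab[OF bi(1,2) j(2)]
        HASC_lab[OF b i j(1)] HASC_lab[OF b i j(2)]
        lab_adjacent_sum[of b i j] lab_adjacent_sum[of "Suc b" 1 j]
        first_last_row_sum[OF assms(3,4)] True
      by (auto split: if_splits)
  qed
qed

lemma mid_n_in: "mid n \<in> {1..n}"
  using n_ge by (auto simp: mid_def)

lemma HASC_mid_column_mono:
  assumes "I \<in> {1..m * r - 2}"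
  shows "if even (I + mid n) then HASC M N m n r x I (mid n) < HASC M N m n r x (I + 2) (mid n)
    else HASC M N m n r x I (mid n) > HASC M N m n r x (I + 2) (mid n)"
proof -
  have "I \<in> {1..m * r}" using assms by auto
  then obtain b i where bi: "b < r" "i \<in> {1..m}" "I = b * m + i"
    by (rule block_coordinates)
  show ?thesis
  proof (cases "i + 2 \<le> m")
    case True
    have i: "i + 2 \<in> {1..m}" using True by simp
    have I: "I + 2 = b * m + (i + 2)" using bi by simp
    show ?thesis
      unfolding I unfolding bi(3) HASC_lab[OF bi(1,2) mid_n_in] HASC_lab[OF bi(1) i mid_n_in]
      using mid_column_mono[of i] bi(2) True
        lab_less_iff[of i "mid n" "i + 2" "mid n" b] lab_less_iff[of "i + 2" "mid n" i "mid n" b]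
      by (auto simp: parity_block odd_m split: if_splits)
  next
    case False
    \<comment> \<open>Here \<open>i\<close> is \<open>m - 1\<close> or \<open>m\<close>, so
      \<open>i'\<close> is 1 or 2: the cell two rows further lies at the start of the next
      copy.\<close>
    define i' where "i' = i + 2 - m"
    have i': "i' \<in> {1..m}" using False bi(2) m_ge by (auto simp: i'_def)
    have I: "I + 2 = Suc b * m + i'" using bi False by (simp add: i'_def)
    have "Suc b * m < Suc b * m + i'" using i' by simp
    also have "\<dots> \<le> m * r" using assms I by auto
    finally have b: "Suc b < r" using mult.commute[of m r] by (metis mult_less_cancel2)
    have g: "(i, mid n) \<in> Grid m n" "(i', mid n) \<in> Grid m n"
      using bi(2) i' mid_n_in by (auto simp: Grid_def)
    have "Suc b * m + i' + mid n = b * m + i + mid n + 2" using I bi(3) by simp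
    then have "even (b * m + i + mid n) \<longleftrightarrow> even (Suc b * m + i' + mid n)"
      by (metis dvd_add_left_iff dvd_refl)
    from lab_next_block[OF g this]
    show ?thesis
      unfolding I unfolding bi(3) HASC_lab[OF bi(1,2) mid_n_in] HASC_lab[OF b i' mid_n_in] .
  qed
qed

text \<open>With \<open>r = 2 * r0 + 1\<close> copies, the middle row of the large grid is the
  middle row of copy \<open>r0\<close>, so everything happens in one copy.\<close>

lemma HASC_mid_row_mono:
  assumes "odd r" and j: "j \<in> {1..n - 2}"
  shows "if even (mid (m * r) + j)
    then HASC M N m n r x (mid (m * r)) j < HASC M N m n r x (mid (m * r)) (j + 2)
    else HASC M N m n r x (mid (m * r)) j > HASC M N m n r x (mid (m * r)) (j + 2)"
proof -
  obtain r0 where r0: "r = 2 * r0 + 1" using assms by (auto elim: oddE)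
  obtain m0 where m0: "m = 2 * m0 + 1" using odd_m by (auto elim: oddE)
  have "m * r = 2 * (r0 * m + m0) + 1" unfolding r0 by (simp add: m0 algebra_simps)
  then have mid: "mid (m * r) = r0 * m + mid m" by (simp add: mid_def m0)
  have r: "r0 < r" and mm: "mid m \<in> {1..m}" and jj: "j \<in> {1..n}" "j + 2 \<in> {1..n}"
    using r0 m0 j by (auto simp: mid_def)
  show ?thesis
    unfolding mid HASC_lab[OF r mm jj(1)] HASC_lab[OF r mm jj(2)]
    using mid_row_mono[OF j]
      lab_less_iff[of "mid m" j "mid m" "j + 2" r0] lab_less_iff[of "mid m" "j + 2" "mid m" j r0]
    by (auto simp: parity_block odd_m split: if_splits)
qed

text \<open>The point reflection of the large grid sends copy \<open>b\<close> to copy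
  \<open>2 * r0 - b\<close> and reflects the position inside it, which reduces the claim to
  \<open>lab_balance\<close>.\<close>

lemma HASC_balance:
  assumes r: "r = 2 * r0 + 1" and g: "(I, j) \<in> Grid (m * r) n"
  shows "HASC M N m n r x I j + HASC M N m n r x (m * r + 1 - I) (n + 1 - j) =
    (if even (I + j) then int r0 * s + t + 2 else 2 * (int M * int N) - int r0 * s - t + 1)"
proof -
  have I: "I \<in> {1..m * r}" and j: "j \<in> {1..n}" using g by (auto simp: Grid_def)
  obtain b i where bi: "b < r" "i \<in> {1..m}" "I = b * m + i"
    using I by (rule block_coordinates)
  have b: "b \<le> 2 * r0" using bi r by simp
  have "m * r = (2 * r0 - b) * m + b * m + m"
    using b by (simp add: r algebra_simps flip: add_mult_distrib2)
  then have I': "m * r + 1 - I = (2 * r0 - b) * m + (m + 1 - i)" using bi by simp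
  have b': "2 * r0 - b < r" and i': "m + 1 - i \<in> {1..m}" and j': "n + 1 - j \<in> {1..n}"
    using r bi j by auto
  have g': "(i, j) \<in> Grid m n" using bi j by (simp add: Grid_def)
  show ?thesis
    unfolding I' HASC_lab[OF b' i' j'] unfolding bi(3) HASC_lab[OF bi(1,2) j]
    by (rule lab_balance[OF g' b])
qed

theorem HASC_balanced:
  assumes "odd r" "m * r \<le> M"
  shows "partial_bicentrally_balanced M N (m * r) n (HASC M N m n r x)"
proof -
  obtain r0 where r0: "r = 2 * r0 + 1" using assms by (auto elim: oddE)
  have s0: "s \<ge> 0" by (simp add: s_def)
  have rs: "int (m * r) * int n = int r * s" by (simp add: s_def)
  \<comment> \<open>For the large grid \<open>r0 * s + t\<close> takes the place of
    \<open>t\<close>.\<close>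
  have rs': "int r * s = 2 * (int r0 * s + t) + 1" using s_eq by (simp add: r0 algebra_simps)
  have h: "(int r * s + 1) div 2 = int r0 * s + t + 1" "int r * s div 2 = int r0 * s + t"
    "(int r * s + 3) div 2 = int r0 * s + t + 2" "(3 - int r * s) div 2 = 1 - int r0 * s - t"
    unfolding rs' by simp_all
  have "mono (\<lambda>b. (int b * s + 1) div 2)"
    using s0 by (intro monoI zdiv_mono1 add_right_mono mult_right_mono) auto
  from UN_consecutive_intervals[OF this, of r]
  have E: "{HASC M N m n r x i j | i j. (i, j) \<in> Grid (m * r) n \<and> even (i + j)} =
      {1..(int r * s + 1) div 2}"
    unfolding HASC_label_set block_even_labels by auto
  have "antimono (\<lambda>b. int M * int N - int b * s div 2)"
    using s0 by (intro antimonoI diff_left_mono zdiv_mono1 mult_right_mono) auto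
  from UN_consecutive_intervals_antimono[OF this, of r]
  have "{HASC M N m n r x i j | i j. (i, j) \<in> Grid (m * r) n \<and> odd (i + j)} =
      {int M * int N - int r * s div 2 <.. int M * int N}"
    unfolding HASC_label_set[where P = "\<lambda>k. odd k"] block_odd_labels by simp
  \<comment> \<open>Since \<open>r * s\<close> is odd, raising \<open>- (r * s div 2)\<close> by 1
    for the closed lower end gives \<open>(3 - r * s) div 2\<close>.\<close>
  also have "\<dots> = {int M * int N + (3 - int r * s) div 2 .. int M * int N}"
    unfolding h by auto
  finally have O: "{HASC M N m n r x i j | i j. (i, j) \<in> Grid (m * r) n \<and> odd (i + j)} = \<dots>" .
  have "m \<le> m * r" using r0 by simp
  then have size: "odd (m * r)" "3 \<le> m * r" using odd_m assms(1) m_ge by (simp, linarith)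
  show ?thesis
    unfolding partial_bicentrally_balanced_def rs
  proof (intro conjI)
    show "\<forall>(i, j)\<in>Grid (m * r) n. even (i + j) \<longrightarrow> HASC M N m n r x i j +
        HASC M N m n r x (m * r + 1 - i) (n + 1 - j) = (int r * s + 3) div 2"
      using HASC_balance[OF r0] unfolding h by auto
    show "\<forall>(i, j)\<in>Grid (m * r) n. odd (i + j) \<longrightarrow> HASC M N m n r x i j +
        HASC M N m n r x (m * r + 1 - i) (n + 1 - j) =
        2 * (int M * int N) + (3 - int r * s) div 2"
      using HASC_balance[OF r0] unfolding h by auto
    show "\<forall>i j. 1 \<le> i \<and> i + 1 \<le> m * r \<and> 1 \<le> j \<and> j + 1 \<le> n \<longrightarrow>
        HASC M N m n r x i j + HASC M N m n r x (i + 1) j + HASC M N m n r x i (j + 1)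
          + HASC M N m n r x (i + 1) (j + 1) = 2 * (int M * int N) + 3"
      by (intro allI impI HASC_face_sum; elim conjE)
    show "\<forall>i\<in>{1..m * r - 2}. even (i + mid n) \<longrightarrow>
        HASC M N m n r x i (mid n) < HASC M N m n r x (i + 2) (mid n)"
      "\<forall>i\<in>{1..m * r - 2}. odd (i + mid n) \<longrightarrow>
        HASC M N m n r x i (mid n) > HASC M N m n r x (i + 2) (mid n)"
      using HASC_mid_column_mono[of _ r, unfolded if_bool_eq_conj] by blast+
    show "\<forall>j\<in>{1..n - 2}. even (mid (m * r) + j) \<longrightarrow>
        HASC M N m n r x (mid (m * r)) j < HASC M N m n r x (mid (m * r)) (j + 2)"
      "\<forall>j\<in>{1..n - 2}. odd (mid (m * r) + j) \<longrightarrow>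
        HASC M N m n r x (mid (m * r)) j > HASC M N m n r x (mid (m * r)) (j + 2)"
      using HASC_mid_row_mono[OF assms(1), unfolded if_bool_eq_conj] by blast+
  qed (fact size odd_n n_ge n_le assms(2) E O)+
qed

end

section \<open>Transposition and the vertical construction\<close>

lemma partial_bicentrally_balanced_transpose:
  assumes "partial_bicentrally_balanced M N p q x"
  shows "partial_bicentrally_balanced N M q p (\<lambda>i j. x j i)"
proof -
  have sets: "{x j i | i j. (i, j) \<in> Grid q p \<and> P (i + j)} =
      {x i j | i j. (i, j) \<in> Grid p q \<and> P (i + j)}" for P
    by (rule Collect_cong, subst ex_comm, intro iff_exI) (auto simp: Grid_def add.commute)
  note b = assms[unfolded partial_bicentrally_balanced_def add.commute[of "mid p"]]
  have balance: "\<forall>(i, j)\<in>Grid q p. P (i + j) \<longrightarrow> x j i + x (p + 1 - j) (q + 1 - i) = c"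
    if "\<forall>(i, j)\<in>Grid p q. P (i + j) \<longrightarrow> x i j + x (p + 1 - i) (q + 1 - j) = c" for P c
  proof safe
    fix i j assume "(i, j) \<in> Grid q p" "P (i + j)"
    then have "(j, i) \<in> Grid p q" "P (j + i)" by (simp_all add: Grid_def add.commute)
    then show "x j i + x (p + 1 - j) (q + 1 - i) = c" using that by blast
  qed
  show ?thesis
    unfolding partial_bicentrally_balanced_def sets[of even] sets[of "\<lambda>k. odd k"]
      mult.commute[of "int q"] mult.commute[of "int N"] add.commute[of "mid q"]
  proof (intro conjI)
    show "\<forall>i j. 1 \<le> i \<and> i + 1 \<le> q \<and> 1 \<le> j \<and> j + 1 \<le> p \<longrightarrow>
        x j i + x j (i + 1) + x (j + 1) i + x (j + 1) (i + 1) = 2 * (int M * int N) + 3"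
    proof (intro allI impI)
      fix i j assume "1 \<le> i \<and> i + 1 \<le> q \<and> 1 \<le> j \<and> j + 1 \<le> p"
      then have "x j i + x (j + 1) i + x j (i + 1) + x (j + 1) (i + 1) = 2 * (int M * int N) + 3"
        using b by blast
      then show "x j i + x j (i + 1) + x (j + 1) i + x (j + 1) (i + 1) = 2 * (int M * int N) + 3"
        by linarith
    qed
    show "\<forall>(i, j)\<in>Grid q p. even (i + j) \<longrightarrow>
        x j i + x (p + 1 - j) (q + 1 - i) = (int p * int q + 3) div 2"
      using b by (intro balance) blast
    show "\<forall>(i, j)\<in>Grid q p. odd (i + j) \<longrightarrow>
        x j i + x (p + 1 - j) (q + 1 - i) = 2 * (int M * int N) + (3 - int p * int q) div 2"
      using b by (intro balance[where P = "\<lambda>k. odd k"]) blast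
  qed (use b in blast)+
qed

text \<open>Apart from the value of \<open>x\<close>, a label depends only on \<open>b\<close>,
  \<open>i + j\<close>, \<open>m * n\<close> and \<open>M * N\<close>, all unaffected by swapping
  the coordinates.\<close>

lemma VASC_eq_HASC_transpose:
  "VASC M N m n r x = (\<lambda>i j. HASC N M n m r (\<lambda>i j. x j i) j i)"
  by (intro ext) (auto simp: VASC_def HASC_def Grid_def asc_label_def Let_def ac_simps)

lemma HASC_partial_bicentrally_balanced:
  assumes "partial_bicentrally_balanced M N m n x" "odd r" "m * r \<le> M"
  shows "partial_bicentrally_balanced M N (m * r) n (HASC M N m n r x)"
proof -
  have "odd (int m * int n)" using assms(1) by (simp add: partial_bicentrally_balanced_def)
  then obtain t where "int m * int n = 2 * t + 1" by (elim oddE)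
  then interpret balanced_labeling M N m n x "int m * int n" t
    using assms(1) by unfold_locales auto
  show ?thesis using assms(2,3) by (rule HASC_balanced)
qed

theorem theorem38:
  fixes M N m n :: nat and x :: "nat \<Rightarrow> nat \<Rightarrow> int"
  assumes "odd m" and "odd n" and "odd M" and "odd N"
    and "3 \<le> m" and "3 \<le> n" and "m \<le> M" and "n \<le> N"
    and "partial_bicentrally_balanced M N m n x"
  shows "(\<forall>r::nat. odd r \<and> 0 < r \<and> m * r \<le> M \<longrightarrow>
            partial_bicentrally_balanced M N (m * r) n (HASC M N m n r x)) \<and>
         (\<forall>r::nat. odd r \<and> 0 < r \<and> n * r \<le> N \<longrightarrow>
            partial_bicentrally_balanced M N m (n * r) (VASC M N m n r x))"
proof (intro conjI allI impI; elim conjE)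
  fix r :: nat
  assume r: "odd r"
  show "partial_bicentrally_balanced M N (m * r) n (HASC M N m n r x)" if "m * r \<le> M"
    using HASC_partial_bicentrally_balanced[OF assms(9) r that] .
  show "partial_bicentrally_balanced M N m (n * r) (VASC M N m n r x)" if "n * r \<le> N"
    \<comment> \<open>Transpose \<open>x\<close>, extend it horizontally and transpose back.\<close>
    unfolding VASC_eq_HASC_transpose
    using HASC_partial_bicentrally_balanced
      [OF partial_bicentrally_balanced_transpose[OF assms(9)] r that]
    by (rule partial_bicentrally_balanced_transpose)
qed

end
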